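(* Let $a$ and $b$ be two integers greater than or equal to $2$, coprime, and such that $d:=ab$ is not a perfect square. Let $(u_n)_{n\ge0}$ and $(v_n)_{n\ge0}$ be the sequences associated with $\sqrt d$ (defined in the context), let $\frac{p_n}{q_n}$ be the convergent of index $n$ in the continued fraction expansion of $\sqrt d$, and let $T$ be the smallest period of this expansion. Put $N=\frac T2$. Consider the equation $$(E_2):\quad ax^2-by^2=1$$ with unknown $(x,y)\in\mathbb N^2$. 1. If $a<b$, then $(E_2)$ has a solution if and only if $T\equiv 0\pmod 4$, $v_N=a$ and $v_N$ divides $u_N$. Moreover, in this case, the set of solutions of $(E_2)$ is $$\left\{\left(\frac{p_{N-1+\ell T}}{a},\ q_{N-1+\ell T}\right) : \ell\in\mathbb N\right\}.$$ 2. If $b<a$, then $(E_2)$ has a solution if and only if $T\equiv 2\pmod 4$, $v_N=b$ and $v_N$ divides $u_N$. Moreover, in this case, the set of solutions of $(E_2)$ is $$\left\{\left(q_{N-1+\ell T},\ \frac{p_{N-1+\ell T}}{b}\right) : \ell\in\mathbb N\right\}.$$ 3. In particular, $(E_2)$ has no solution if $T$ is odd.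
   Context: $\mathbb N=\{0,1,2,\dots\}$. The conditions involving $u_N,v_N$ are only relevant when $T$ is even, in which case $N=T/2$ is an integer. Continued fractions: for an irrational $z$, put $z_0:=z$, $a_n:=\lfloor z_n\rfloor$ and $z_{n+1}:=1/(z_n-a_n)$ for $n\ge0$; the $z_n$ are the complete quotients of $z$, the $a_n$ are its partial quotients, and the continued fraction expansion of $z$ is $z=[a_0,a_1,a_2,\dots]$. The convergent of index $n$ is $[a_0,\dots,a_n]=\frac{p_n}{q_n}$ (in lowest terms), where $p_{-2}=0$, $p_{-1}=1$, $q_{-2}=1$, $q_{-1}=0$ and $p_n=a_np_{n-1}+p_{n-2}$, $q_n=a_nq_{n-1}+q_{n-2}$ for $n\ge 0$. Let $d$ be a natural number that is not a perfect square. The partial quotients of $\sqrt d$ are periodic from rank $1$; $T\ge1$ denotes the smallest period. Put $\xi:=\lfloor\sqrt d\rfloor+\sqrt d$ and let $(\xi_n)_{n\ge0}$ be the sequence of complete quotients of $\xi$. The sequences $(u_n)_{n\ge0}$ and $(v_n)_{n\ge0}$ associated with $\sqrt d$ are the (unique) sequences of positive integers such that $\xi_n=\frac{u_n+\sqrt d}{v_n}$ for all $n\ge0$. Equivalently, $u_0=\lfloor\sqrt d\rfloor$, $v_0=1$ and $u_{n+1}=\lfloor \xi_n\rfloor v_n-u_n$, $v_{n+1}=\frac{d-u_{n+1}^2}{v_n}$. *)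

theory Defs
  imports Complex_Main "HOL-Computational_Algebra.Nth_Powers"
begin

text \<open>Continued fractions. The definitions are total; they are meant for irrational \<open>z\<close>.\<close>

primrec complete_quotient :: "real \<Rightarrow> nat \<Rightarrow> real" where
  "complete_quotient z 0 = z"
| "complete_quotient z (Suc n) =
     1 / (complete_quotient z n - of_int \<lfloor>complete_quotient z n\<rfloor>)"

definition partial_quotient :: "real \<Rightarrow> nat \<Rightarrow> int" where
  "partial_quotient z n = \<lfloor>complete_quotient z n\<rfloor>"

text \<open>Numerators and denominators of the convergents \<open>[a\<^sub>0, \<dots>, a\<^sub>n] = p\<^sub>n / q\<^sub>n\<close>. The values at \<open>0\<close> and
  \<open>1\<close> are those given by the three-term recurrence from \<open>p\<^sub>-\<^sub>2 = 0\<close>, \<open>p\<^sub>-\<^sub>1 = 1\<close>, \<open>q\<^sub>-\<^sub>2 = 1\<close>,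
  \<open>q\<^sub>-\<^sub>1 = 0\<close>.\<close>

fun conv_num :: "real \<Rightarrow> nat \<Rightarrow> int" where
  "conv_num z 0 = partial_quotient z 0"
| "conv_num z (Suc 0) = partial_quotient z 1 * partial_quotient z 0 + 1"
| "conv_num z (Suc (Suc n)) =
     partial_quotient z (Suc (Suc n)) * conv_num z (Suc n) + conv_num z n"

fun conv_denom :: "real \<Rightarrow> nat \<Rightarrow> int" where
  "conv_denom z 0 = 1"
| "conv_denom z (Suc 0) = partial_quotient z 1"
| "conv_denom z (Suc (Suc n)) =
     partial_quotient z (Suc (Suc n)) * conv_denom z (Suc n) + conv_denom z n"

text \<open>The smallest period, from rank \<open>1\<close> on, of the partial quotients of \<open>z\<close>.\<close>

definition cf_period :: "real \<Rightarrow> nat" where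
  "cf_period z =
     (LEAST T. 1 \<le> T \<and> (\<forall>n\<ge>1. partial_quotient z (n + T) = partial_quotient z n))"

text \<open>\<open>u\<close> and \<open>v\<close> are the sequences associated with \<open>sqrt d\<close>.\<close>

definition associated_seqs :: "nat \<Rightarrow> (nat \<Rightarrow> nat) \<Rightarrow> (nat \<Rightarrow> nat) \<Rightarrow> bool" where
  "associated_seqs d u v \<longleftrightarrow>
     (\<forall>n. 0 < u n \<and> 0 < v n \<and>
          complete_quotient (of_int \<lfloor>sqrt (real d)\<rfloor> + sqrt (real d)) n
            = (real (u n) + sqrt (real d)) / real (v n))"

text \<open>Existence and uniqueness of the associated sequences.\<close>

lemma sqrt_irrational:
  assumes "\<not> is_square (d::nat)"
  shows "sqrt (real d) \<notin> \<rat>"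
proof
  assume "sqrt (real d) \<in> \<rat>"
  then obtain m n :: nat where n: "n \<noteq> 0" "\<bar>sqrt (real d)\<bar> = real m / real n" "coprime m n"
    by (rule Rats_abs_nat_div_natE)
  then have "sqrt (real d) * real n = real m"
    by (simp add: field_simps)
  then have "(sqrt (real d) * real n)^2 = (real m)^2"
    by simp
  then have "real (d * n^2) = real (m^2)"
    by (simp add: power_mult_distrib)
  then have eq: "d * n^2 = m^2"
    using of_nat_eq_iff by blast
  then have "n^2 dvd m^2"
    by (metis dvd_triv_right)
  then have "n dvd m"
    by simp
  then have "n = 1"
    using n(3) by (metis coprime_common_divisor_nat dvd_refl)
  then have "d = m^2"
    using eq by simp
  then show False
    using assms by (auto simp: is_nth_power_def)
qed

definition reduced_form :: "nat \<Rightarrow> nat \<Rightarrow> nat \<Rightarrow> bool" where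
  "reduced_form d u v \<longleftrightarrow> 0 < u \<and> 0 < v \<and> int v dvd int d - int u ^ 2 \<and>
     real u < sqrt (real d) \<and> sqrt (real d) - real u < real v \<and> real v < sqrt (real d) + real u"

lemma reduced_form_step:
  assumes d: "\<not> is_square (d::nat)" and r: "reduced_form d u v"
    and x: "x = (real u + sqrt (real d)) / real v"
  shows "\<exists>u' v'. reduced_form d u' v' \<and>
           1 / (x - of_int \<lfloor>x\<rfloor>) = (real u' + sqrt (real d)) / real v'"
proof -
  define s where "s = sqrt (real d)"
  have irr: "s \<notin> \<rat>"
    using sqrt_irrational[OF d] s_def by simp
  have ss: "s^2 = real d"
    by (simp add: s_def)
  from r have u: "0 < u" and v: "0 < v" and dv: "int v dvd int d - int u ^ 2"
    and us: "real u < s" and l: "s - real u < real v" and h: "real v < s + real u"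
    by (auto simp: reduced_form_def s_def)
  define A where "A = \<lfloor>x\<rfloor>"
  have xv: "x * real v = real u + s"
    using v x by (simp add: s_def)
  have A1: "1 \<le> A"
    using h v xv unfolding A_def by (simp add: le_floor_iff x s_def add.commute)
  define U where "U = A * int v - int u"
  have "of_int A * real v \<le> x * real v"
    using v by (intro mult_right_mono) (auto simp: A_def)
  then have "of_int U \<le> s"
    using xv by (simp add: U_def)
  moreover have "of_int U \<noteq> s"
    using irr by auto
  ultimately have Us: "of_int U < s"
    by simp
  have "x * real v < (of_int A + 1) * real v"
    using v by (intro mult_strict_right_mono) (auto simp: A_def)
  then have sU: "s < of_int U + real v"
    using xv by (simp add: U_def algebra_simps)
  have Av: "real v \<le> of_int A * real v"
    using A1 v by simp
  have U0: "0 < U"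
  proof (rule ccontr)
    assume "\<not> 0 < U"
    then have "A * int v \<le> int u"
      by (simp add: U_def)
    then have "of_int A * real v \<le> real u"
      by (metis of_int_le_iff of_int_mult of_int_of_nat_eq)
    moreover have "(of_int U :: real) \<le> 0"
      using \<open>\<not> 0 < U\<close> by simp
    ultimately show False
      using sU us Av by linarith
  qed
  have "int d - U^2 = (int d - int u ^ 2) + int v * (A * (2 * int u - A * int v))"
    by (simp add: U_def algebra_simps power2_eq_square)
  then have "int v dvd int d - U^2"
    using dvd_add[OF dv dvd_triv_left] by metis
  then obtain V where V: "int d - U^2 = int v * V" ..
  have "real_of_int (int d - U^2) = of_int (int v * V)"
    using V by simp
  then have VR: "(s - of_int U) * (s + of_int U) = real v * of_int V"
    using ss by (simp add: algebra_simps power2_eq_square)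
  have pos: "0 < s - of_int U" "0 < s + of_int U"
    using Us U0 by auto
  then have "0 < real v * of_int V"
    using VR by (metis mult_pos_pos)
  then have V0: "0 < V"
    using v by (simp add: zero_less_mult_iff)
  have V1: "of_int V < s + of_int U"
  proof -
    have "real v * of_int V < real v * (s + of_int U)"
      unfolding VR[symmetric] using pos sU by (intro mult_strict_right_mono) auto
    then show ?thesis
      using v by simp
  qed
  have vs: "real v < s + of_int U"
    using Av us by (simp add: U_def)
  have V2: "s - of_int U < of_int V"
  proof -
    have "(s - of_int U) * real v < (s - of_int U) * (s + of_int U)"
      using pos vs by (intro mult_strict_left_mono) auto
    then show ?thesis
      using VR v by (simp add: mult.commute)
  qed
  have "int (nat U) = U" "int (nat V) = V"
    using U0 V0 by auto
  then have R: "real (nat U) = of_int U" "real (nat V) = of_int V"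
    by (metis of_int_of_nat_eq)+
  have "reduced_form d (nat U) (nat V)"
    using U0 V0 Us V1 V2 V R unfolding reduced_form_def s_def[symmetric] by auto
  moreover have "1 / (x - of_int \<lfloor>x\<rfloor>) = (real (nat U) + s) / real (nat V)"
  proof -
    have "x - of_int A = (s - of_int U) / real v"
      using v by (simp add: x s_def U_def field_simps)
    then have "1 / (x - of_int A) = real v / (s - of_int U)"
      by simp
    also have "\<dots> = (of_int U + s) / of_int V"
      using VR pos V0 by (simp add: frac_eq_eq mult.commute add.commute)
    finally show ?thesis
      by (simp add: R A_def)
  qed
  ultimately show ?thesis
    using s_def by blast
qed

lemma associated_seqs_exist:
  assumes d: "\<not> is_square (d::nat)"
  shows "\<exists>u v. associated_seqs d u v"
proof -
  define z where "z = of_int \<lfloor>sqrt (real d)\<rfloor> + sqrt (real d)"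
  have irr: "sqrt (real d) \<notin> \<rat>"
    by (rule sqrt_irrational[OF d])
  have "d \<noteq> 0"
    using d by (metis is_nth_power_def zero_power2)
  then have s1: "1 \<le> sqrt (real d)"
    by simp
  have "\<exists>u v. reduced_form d u v \<and>
          complete_quotient z n = (real u + sqrt (real d)) / real v" for n
  proof (induction n)
    case 0
    define k where "k = nat \<lfloor>sqrt (real d)\<rfloor>"
    have k: "real k = of_int \<lfloor>sqrt (real d)\<rfloor>" "0 < k"
      using s1 by (auto simp: k_def le_floor_iff)
    have "real k \<noteq> sqrt (real d)"
      using irr by (metis Rats_of_nat)
    moreover have "real k \<le> sqrt (real d)"
      using k by simp
    moreover have "sqrt (real d) < real k + 1"
      using k by linarith
    ultimately have "real k < sqrt (real d)" "sqrt (real d) - real k < real 1"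
        "real 1 < sqrt (real d) + real k"
      using k(2) s1 by linarith+
    then have "reduced_form d k 1"
      unfolding reduced_form_def using k(2) by simp
    then show ?case
      using k by (intro exI[of _ k] exI[of _ 1]) (simp add: z_def)
  next
    case (Suc n)
    then show ?case
      using reduced_form_step[OF d] by auto
  qed
  then obtain u v where "\<And>n. reduced_form d (u n) (v n) \<and>
          complete_quotient z n = (real (u n) + sqrt (real d)) / real (v n)"
    by metis
  then have "associated_seqs d u v"
    by (auto simp: associated_seqs_def reduced_form_def z_def)
  then show ?thesis
    by blast
qed

lemma associated_seqs_unique:
  assumes d: "\<not> is_square (d::nat)"
    and 1: "associated_seqs d u v" and 2: "associated_seqs d u' v'"
  shows "u = u' \<and> v = v'"
proof -
  define s where "s = sqrt (real d)"
  have irr: "s \<notin> \<rat>"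
    using sqrt_irrational[OF d] s_def by simp
  have "u n = u' n \<and> v n = v' n" for n
  proof -
    have p: "0 < v n" "0 < v' n"
      using 1 2 by (auto simp: associated_seqs_def)
    have "(real (u n) + s) / real (v n) = (real (u' n) + s) / real (v' n)"
      using 1 2 by (simp add: associated_seqs_def s_def)
    then have e: "s * (real (v' n) - real (v n))
                    = real (u' n) * real (v n) - real (u n) * real (v' n)"
      using p by (simp add: field_simps)
    have v: "real (v' n) = real (v n)"
    proof (rule ccontr)
      assume "real (v' n) \<noteq> real (v n)"
      then have "s = (real (u' n) * real (v n) - real (u n) * real (v' n))
                       / (real (v' n) - real (v n))"
        using e by (simp add: eq_divide_eq)
      also have "\<dots> \<in> \<rat>"
        by simp
      finally show False
        using irr by simp
    qed
    then show ?thesis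
      using e p by simp
  qed
  then show ?thesis
    by auto
qed

end

theory Submission
  imports Defs
begin

text \<open>
  Write \<open>s\<close> for the square root of \<open>d\<close>. A solution of \<open>a x\<^sup>2 - b y\<^sup>2 = 1\<close>, multiplied by the smaller
  coefficient \<open>c\<close>, gives a coprime pair \<open>(P, Q)\<close> with \<open>P\<^sup>2 - d Q\<^sup>2 = \<plusminus>c\<close>: either \<open>P = a x\<close>, \<open>Q = y\<close> with
  sign \<open>+\<close> if \<open>c = a\<close>, or \<open>P = b y\<close>, \<open>Q = x\<close> with sign \<open>-\<close> if \<open>c = b\<close>. Both cases are therefore
  instances of one equation \<open>c x\<^sup>2 - e y\<^sup>2 = \<plusminus>1\<close> with \<open>c < e\<close> and \<open>c e = d\<close>, treated in
  \<open>solution_set\<close>.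

  Since \<open>c < s\<close>, Lagrange's theorem (\<open>small_norm_convergent\<close>) makes \<open>P / Q\<close> a convergent, say the
  one of index \<open>k - 1\<close>. Its norm is \<open>(-1)\<^sup>k v\<^sub>k\<close> (\<open>norm_convergent\<close>), so \<open>v\<^sub>k = c\<close>, and the parity
  of \<open>k\<close> is the sign; moreover \<open>c\<close> divides \<open>P = Q u\<^sub>k + q\<^sub>k\<^sub>-\<^sub>2 c\<close> and is coprime to \<open>Q\<close>, so \<open>c\<close>
  divides \<open>u\<^sub>k\<close>. Conversely these conditions on \<open>k\<close> give a solution by the same formulas.

  It remains to locate such \<open>k\<close>. If \<open>v\<^sub>k\<close> divides \<open>2 u\<^sub>k\<close>, the sequence of states is symmetric about
  \<open>k\<close> (\<open>states_symmetric\<close>), hence \<open>v\<^sub>2\<^sub>k = v\<^sub>0 = 1\<close>. The indices where \<open>v\<close> equals \<open>1\<close> are the multiples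
  of the least period \<open>T\<close> (\<open>T_dvd\<close>, \<open>state_shift_mult\<close>). So \<open>T\<close> divides \<open>2 k\<close> but, as \<open>c \<noteq> 1\<close>, not
  \<open>k\<close>; this means that \<open>T\<close> is even and \<open>k\<close> is \<open>T / 2\<close> plus a multiple of \<open>T\<close>
  (\<open>symmetric_state\<close>). In particular \<open>k\<close> and \<open>T / 2\<close> have the same parity, which turns the
  sign into the condition on \<open>T\<close> modulo \<open>4\<close>.
\<close>

section \<open>The states of the expansion\<close>

locale sqrt_cf =
  fixes d :: nat and u v :: "nat \<Rightarrow> nat"
  assumes nonsquare: "\<not> is_square d" and assoc: "associated_seqs d u v"
begin

definition s :: real where "s = sqrt (real d)"

text \<open>
  The complete quotients of \<open>\<lfloor>s\<rfloor> + s\<close>. They agree with those of \<open>s\<close> from rank \<open>1\<close> on, but are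
  periodic from rank \<open>0\<close>; so rank \<open>0\<close> can serve as the state \<open>(\<lfloor>s\<rfloor>, 1)\<close> that every period returns to.
\<close>

definition xi :: "nat \<Rightarrow> real" where "xi = complete_quotient (of_int \<lfloor>s\<rfloor> + s)"

lemma s_squared: "s * s = real d"
  by (simp add: s_def)

lemma s_irrational: "s \<notin> \<rat>"
  using sqrt_irrational[OF nonsquare] by (simp add: s_def)

lemma s_gt_1: "1 < s"
proof -
  have "d \<noteq> 0" "d \<noteq> 1"
    using nonsquare by (metis is_nth_power_def zero_power2, metis is_nth_power_def one_power2)
  then show ?thesis by (simp add: s_def)
qed

lemma floor_s_pos: "0 < \<lfloor>s\<rfloor>"
  using s_gt_1 by linarith

lemma irrational_coeff:
  fixes a b :: int
  assumes "s * of_int a = of_int b"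
  shows "a = 0" "b = 0"
proof -
  show "a = 0"
  proof (rule ccontr)
    assume "a \<noteq> 0"
    then have "s = of_int b / of_int a"
      using assms by (simp add: field_simps)
    then show False using s_irrational by simp
  qed
  then show "b = 0" using assms by simp
qed

lemma u_pos: "0 < u n" and v_pos: "0 < v n" and xi_eq: "xi n = (real (u n) + s) / real (v n)"
  using assoc by (simp_all add: associated_seqs_def xi_def s_def)

lemma xi_Suc: "xi (Suc n) = 1 / (xi n - of_int \<lfloor>xi n\<rfloor>)"
  by (simp add: xi_def)

lemma state_unique:
  assumes "(real a + s) / real b = (real a' + s) / real b'" "0 < b" "0 < b'"
  shows "a = a'" "b = b'"
proof -
  have "s * of_int (int b' - int b) = of_int (int a' * int b - int a * int b')"
    using assms by (simp add: field_simps)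
  note * = irrational_coeff[OF this]
  show "b = b'" using *(1) by simp
  then show "a = a'" using * assms by simp
qed

lemma u_0: "int (u 0) = \<lfloor>s\<rfloor>" and v_0: "v 0 = 1"
proof -
  have "(real (nat \<lfloor>s\<rfloor>) + s) / real 1 = (real (u 0) + s) / real (v 0)"
    using floor_s_pos xi_eq[of 0] by (simp add: xi_def)
  note * = state_unique[OF this _ v_pos]
  show "v 0 = 1" using *(2) by simp
  have "u 0 = nat \<lfloor>s\<rfloor>" using *(1) by simp
  then show "int (u 0) = \<lfloor>s\<rfloor>" using floor_s_pos by simp
qed

lemma reduced: "reduced_form d (u n) (v n)"
proof (induction n)
  case 0
  have "of_int \<lfloor>s\<rfloor> \<noteq> s" using s_irrational by (metis Rats_of_int)
  moreover have "of_int \<lfloor>s\<rfloor> \<le> s" "s < of_int \<lfloor>s\<rfloor> + 1" by linarith+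
  moreover have "real (u 0) = of_int \<lfloor>s\<rfloor>" by (metis u_0 of_int_of_nat_eq)
  ultimately have "real (u 0) < s" "s < real (u 0) + 1" by linarith+
  then show ?case
    using s_gt_1 u_pos[of 0] v_0 unfolding reduced_form_def s_def[symmetric] by auto
next
  case (Suc n)
  obtain u' v' where *: "reduced_form d u' v'" "xi (Suc n) = (real u' + s) / real v'"
    using reduced_form_step[OF nonsquare Suc, folded s_def, OF xi_eq, folded xi_Suc] by blast
  moreover have "0 < v'" using * by (simp add: reduced_form_def)
  ultimately have "u (Suc n) = u'" "v (Suc n) = v'"
    using state_unique[of "u (Suc n)" "v (Suc n)" u' v', folded xi_eq] v_pos by auto
  then show ?case using * by simp
qed

lemma u_lt: "real (u n) < s" and lt_u_add_v: "s < real (u n) + real (v n)"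
  and v_lt: "real (v n) < s + real (u n)"
  using reduced[of n] by (auto simp: reduced_form_def s_def)

lemma xi_gt_1: "1 < xi n"
  using v_lt[of n] v_pos[of n] by (simp add: xi_eq field_simps)

text \<open>
  The recurrences come from \<open>(u\<^sub>n\<^sub>+\<^sub>1 + s) (s - U) = v\<^sub>n v\<^sub>n\<^sub>+\<^sub>1\<close> with \<open>U = \<lfloor>xi n\<rfloor> v\<^sub>n - u\<^sub>n\<close>, by comparing
  the rational parts and the coefficients of \<open>s\<close>.
\<close>

lemma u_Suc: "int (u (Suc n)) = \<lfloor>xi n\<rfloor> * int (v n) - int (u n)" (is ?U)
  and v_Suc: "int (v n) * int (v (Suc n)) = int d - (int (u (Suc n)))\<^sup>2" (is ?V)
proof -
  define U where "U = \<lfloor>xi n\<rfloor> * int (v n) - int (u n)"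
  have frac: "xi n - of_int \<lfloor>xi n\<rfloor> = (s - of_int U) / real (v n)"
    using v_pos[of n] by (simp add: xi_eq U_def field_simps)
  have "s \<noteq> of_int U" using s_irrational by (metis Rats_of_int)
  then have "(real (u (Suc n)) + s) * (s - of_int U) = real (v n) * real (v (Suc n))"
    using xi_Suc[of n] v_pos[of "Suc n"] unfolding frac xi_eq[of "Suc n"] by (simp add: field_simps)
  then have "s * of_int (int (u (Suc n)) - U)
      = of_int (int (v n) * int (v (Suc n)) - int d + int (u (Suc n)) * U)"
    using s_squared by (simp add: algebra_simps)
  note * = irrational_coeff[OF this]
  show ?U using *(1) by (simp add: U_def)
  show ?V using * by (simp add: power2_eq_square)
qed

lemma lt_u_Suc_add_v: "s < real (u (Suc n)) + real (v n)"
proof -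
  have "xi n * real (v n) < (of_int \<lfloor>xi n\<rfloor> + 1) * real (v n)"
    using v_pos by (intro mult_strict_right_mono) auto
  moreover have "real (u (Suc n)) = of_int \<lfloor>xi n\<rfloor> * real (v n) - real (u n)"
    using arg_cong[OF u_Suc[of n], of real_of_int] by simp
  moreover have "xi n * real (v n) = real (u n) + s"
    using v_pos[of n] by (simp add: xi_eq)
  ultimately show ?thesis by (simp add: algebra_simps)
qed

text \<open>
  The interval \<open>(s - v\<^sub>n, s)\<close> contains one integer of each residue class modulo \<open>v\<^sub>n\<close>, and \<open>u\<^sub>n\<^sub>+\<^sub>1\<close> is
  the one congruent to \<open>-u\<^sub>n\<close>. As \<open>u\<^sub>n\<close> lies in the same interval, this determines
  the expansion in both directions and makes the reflection argument below possible without floors.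
\<close>

lemma u_Suc_unique:
  assumes "int (v n) dvd int (u n) + int w" "real w < s" "s < real w + real (v n)"
  shows "u (Suc n) = w"
proof -
  have "int (v n) dvd int (u n) + int (u (Suc n))" by (simp add: u_Suc)
  from dvd_diff[OF this assms(1)] have dv: "int (v n) dvd int (u (Suc n)) - int w" by simp
  have "\<bar>int (u (Suc n)) - int w\<bar> < int (v n)"
    using assms u_lt[of "Suc n"] lt_u_Suc_add_v[of n] by linarith
  then have "int (u (Suc n)) - int w = 0"
    using dv zdvd_not_zless[of "\<bar>int (u (Suc n)) - int w\<bar>" "int (v n)"] by auto
  then show ?thesis by simp
qed

section \<open>Periods and symmetry of the states\<close>

text \<open>
  The hypothesis says \<open>u\<^sub>m\<close> is congruent to \<open>-u\<^sub>m\<close> modulo \<open>v\<^sub>m\<close>, so \<open>u\<^sub>m\<^sub>+\<^sub>1 = u\<^sub>m\<close>. From there the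
  symmetry spreads outwards: \<open>v\<^sub>n v\<^sub>n\<^sub>+\<^sub>1 = d - u\<^sub>n\<^sub>+\<^sub>1\<^sup>2\<close> is symmetric in its two \<open>v\<close>, and
  \<open>u_Suc_unique\<close> treats \<open>u\<^sub>n\<close> and \<open>u\<^sub>n\<^sub>+\<^sub>1\<close> alike.
\<close>

lemma states_symmetric:
  assumes "v m dvd 2 * u m" "j \<le> m"
  shows "v (m + j) = v (m - j)" "u (Suc (m + j)) = u (m - j)"
proof -
  have "v (m + j) = v (m - j) \<and> u (Suc (m + j)) = u (m - j)"
    using assms(2)
  proof (induction j)
    case 0
    have "int (v m) dvd int (u m) + int (u m)"
      using assms(1) by (metis int_dvd_int_iff mult_2 of_nat_add)
    then show ?case using u_Suc_unique[of m "u m"] u_lt lt_u_add_v by simp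
  next
    case (Suc j)
    then have IH: "v (m + j) = v (m - j)" "u (Suc (m + j)) = u (m - j)" by auto
    define k where "k = m - Suc j"
    have k: "m - j = Suc k" using Suc.prems by (simp add: k_def)
    have "int (v (m + j)) * int (v (Suc (m + j))) = int (v k) * int (v (Suc k))"
      using v_Suc[of "m + j"] v_Suc[of k] IH k by simp
    then have v: "v (Suc (m + j)) = v k"
      using IH k v_pos[of "Suc k"] by auto
    have "int (v k) dvd int (u (Suc k)) + int (u k)" by (simp add: u_Suc)
    then have "u (Suc (Suc (m + j))) = u k"
      using u_Suc_unique[of "Suc (m + j)" "u k"] v IH k u_lt lt_u_add_v[of k] by simp
    then show ?case using v by (simp add: k_def)
  qed
  then show "v (m + j) = v (m - j)" "u (Suc (m + j)) = u (m - j)" by auto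
qed

lemma v_twice_symmetric: "v m dvd 2 * u m \<Longrightarrow> v (2 * m) = 1"
  using states_symmetric(1)[of m m] v_0 by (simp add: mult_2)

text \<open>If \<open>v\<^sub>R = 1\<close>, then \<open>s - 1 < u\<^sub>R < s\<close> leaves only the initial state.\<close>

lemma state_shift:
  assumes "v R = 1"
  shows "xi (n + R) = xi n"
proof (induction n)
  case 0
  have "u R = u 0"
    using lt_u_add_v[of R] u_lt[of R] lt_u_add_v[of 0] u_lt[of 0] assms v_0 by linarith
  then show ?case using xi_eq assms v_0 by simp
next
  case (Suc n)
  then show ?case by (simp add: xi_Suc)
qed

lemma xi_eqD:
  assumes "xi n = xi m"
  shows "u n = u m" "v n = v m"
  using state_unique[of "u n" "v n" "u m" "v m", folded xi_eq, OF assms] v_pos by simp_all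

lemma state_shift_mult:
  assumes "v R = 1"
  shows "u (n + l * R) = u n" "v (n + l * R) = v n"
proof -
  have "xi (n + l * R) = xi n"
  proof (induction l)
    case (Suc l)
    then show ?case using state_shift[OF assms, of "n + l * R"] by (simp add: ac_simps)
  qed simp
  from xi_eqD[OF this] show "u (n + l * R) = u n" "v (n + l * R) = v n" .
qed

lemma complete_quotient_Suc: "complete_quotient s (Suc n) = xi (Suc n)"
  by (induction n) (simp_all add: xi_def)

lemma partial_quotient_pos: "1 \<le> n \<Longrightarrow> partial_quotient s n = \<lfloor>xi n\<rfloor>"
  using complete_quotient_Suc[of "n - 1"] by (simp add: partial_quotient_def)

definition T :: nat where "T = cf_period s"

lemma period_of_state:
  assumes "1 \<le> R" "v R = 1"
  shows "1 \<le> R \<and> (\<forall>n\<ge>1. partial_quotient s (n + R) = partial_quotient s n)"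
  using assms state_shift[OF assms(2)] by (simp add: partial_quotient_pos)

text \<open>
  The period \<open>T\<close> is defined by the partial quotients, whereas the symmetry speaks of states; this
  lemma bridges the gap. If two complete quotients have the same floor, passing to the next ones
  multiplies their distance by a product of two complete quotients, which exceeds \<open>1\<close>. So the distance
  of \<open>xi (n + K)\<close> from \<open>xi n\<close> would strictly increase with \<open>n\<close> if it were not zero, but it has
  period \<open>R\<close>.
\<close>

lemma state_of_period:
  assumes "1 \<le> R" "v R = 1"
    and "\<forall>n\<ge>1. partial_quotient s (n + K) = partial_quotient s n"
  shows "v K = 1"
proof -
  define D where "D = (\<lambda>n. \<bar>xi (Suc n + K) - xi (Suc n)\<bar>)"
  have step: "D (Suc n) = xi (Suc (Suc n)) * xi (Suc (Suc n) + K) * D n" for n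
  proof -
    define x y where "x = xi (Suc (Suc n))" and "y = xi (Suc (Suc n) + K)"
    have xy: "0 < x" "0 < y"
      using xi_gt_1[of "Suc (Suc n)"] xi_gt_1[of "Suc (Suc n) + K"] by (simp_all add: x_def y_def)
    have fl: "\<lfloor>xi (Suc n + K)\<rfloor> = \<lfloor>xi (Suc n)\<rfloor>"
      using assms(3)[rule_format, of "Suc n"] partial_quotient_pos[of "Suc n + K"] partial_quotient_pos[of "Suc n"] by simp
    have "xi (Suc n) = of_int \<lfloor>xi (Suc n)\<rfloor> + 1 / x"
      "xi (Suc n + K) = of_int \<lfloor>xi (Suc n + K)\<rfloor> + 1 / y"
      by (simp_all add: x_def y_def xi_Suc)
    then have "xi (Suc n + K) - xi (Suc n) = 1 / y - 1 / x"
      using fl by linarith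
    then have "x * y * (xi (Suc n + K) - xi (Suc n)) = x - y"
      using xy by (simp add: field_simps)
    then have "x * y * D n = \<bar>x - y\<bar>"
      using xy unfolding D_def by (metis abs_mult abs_of_pos mult_pos_pos)
    then show ?thesis by (simp add: D_def x_def y_def abs_minus_commute)
  qed
  have "D 0 = 0"
  proof (rule ccontr)
    assume nz: "D 0 \<noteq> 0"
    have pos: "0 < D n" for n
    proof (induction n)
      case 0
      then show ?case using nz by (simp add: D_def)
    next
      case (Suc n)
      then show ?case
        using step[of n] xi_gt_1[of "Suc (Suc n)"] xi_gt_1[of "Suc (Suc n) + K"]
        by (metis less_trans mult_pos_pos zero_less_one)
    qed
    have "D n < D (Suc n)" for n
    proof -
      have "1 < xi (Suc (Suc n)) * xi (Suc (Suc n) + K)"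
        using xi_gt_1 by (intro less_1_mult)
      then show ?thesis using pos[of n] step[of n] by simp
    qed
    then have "strict_mono D" by (simp add: strict_mono_Suc_iff)
    then have "D 0 < D R" using assms(1) by (simp add: strict_monoD)
    moreover have "D R = D 0"
      using state_shift[OF assms(2), of "Suc K"] state_shift[OF assms(2), of "Suc 0"]
      by (simp add: D_def ac_simps)
    ultimately show False by simp
  qed
  then have "xi (Suc K) = xi (Suc 0)" by (simp add: D_def)
  note eq = xi_eqD[OF this]
  then have "int (v K) * int (v (Suc 0)) = int (v 0) * int (v (Suc 0))"
    using v_Suc[of K] v_Suc[of 0] unfolding eq by linarith
  then show ?thesis using v_pos[of "Suc 0"] v_0 by simp
qed

lemma T_period:
  assumes "1 \<le> R" "v R = 1"
  shows "1 \<le> T" "v T = 1" "T \<le> R"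
proof -
  let ?P = "\<lambda>K. 1 \<le> K \<and> (\<forall>n\<ge>1. partial_quotient s (n + K) = partial_quotient s n)"
  have *: "1 \<le> T \<and> (\<forall>n\<ge>1. partial_quotient s (n + T) = partial_quotient s n)"
    unfolding T_def cf_period_def
    using LeastI[where P = ?P, OF period_of_state[OF assms]] .
  show "1 \<le> T" using * by simp
  show "v T = 1" using state_of_period[OF assms] * by blast
  show "T \<le> R"
    unfolding T_def cf_period_def
    using Least_le[where P = ?P, OF period_of_state[OF assms]] .
qed

text \<open>If \<open>v\<^sub>R = 1\<close>, then also \<open>v\<close> is \<open>1\<close> at the remainder of \<open>R\<close> modulo \<open>T\<close>, which by minimality is \<open>0\<close>.\<close>

lemma T_dvd:
  assumes "1 \<le> R" "v R = 1"
  shows "T dvd R"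
proof (rule ccontr)
  assume "\<not> T dvd R"
  then have r: "1 \<le> R mod T" by (simp add: dvd_eq_mod_eq_0)
  have "v (R mod T) = 1"
    using state_shift_mult(2)[OF T_period(2)[OF assms], of "R mod T" "R div T"] assms(2)
    by (simp add: mult.commute)
  from T_period(3)[OF r this] T_period(1)[OF assms] show False
    by (metis leD less_eq_Suc_le mod_less_divisor One_nat_def)
qed

text \<open>
  By symmetry \<open>T\<close> divides \<open>2 k\<close>. The quotient is odd, since \<open>k\<close> itself would otherwise be a multiple
  of \<open>T\<close> and \<open>v\<^sub>k\<close> would be \<open>1\<close>.
\<close>

lemma symmetric_state:
  assumes "v k dvd 2 * u k" "v k \<noteq> 1"
  obtains l where "even T" "k = T div 2 + l * T" "v T = 1"
proof -
  have "k \<noteq> 0" using assms(2) v_0 by (metis)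
  then have k2: "1 \<le> 2 * k" by simp
  note per = v_twice_symmetric[OF assms(1)]
  have vT: "v T = 1" by (rule T_period(2)[OF k2 per])
  obtain j where j: "2 * k = T * j" using T_dvd[OF k2 per] by blast
  have "odd j"
  proof
    assume "even j"
    then obtain i where "j = 2 * i" by blast
    then have "k = 0 + i * T" using j by simp
    then show False using state_shift_mult(2)[OF vT, of 0 i] assms(2) v_0 by metis
  qed
  then obtain l where l: "j = 2 * l + 1" by (rule oddE)
  have "even (T * j)" unfolding j[symmetric] by simp
  then have "even T" using \<open>odd j\<close> by simp
  then obtain t where t: "T = 2 * t" by blast
  have "k = t + l * T" using j unfolding l t by (simp add: algebra_simps)
  then have "k = T div 2 + l * T" using t by simp
  then show ?thesis using vT \<open>even T\<close> that by blast
qed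

section \<open>Convergents and small values of the norm form\<close>

text \<open>
  The convergents with index raised by one, so that the initial value \<open>(1, 0)\<close>
  of index \<open>-1\<close> is available; \<open>pp k / qq k\<close> then goes with the state of index \<open>k\<close>.
\<close>

definition pp :: "nat \<Rightarrow> int" where
  "pp k = (case k of 0 \<Rightarrow> 1 | Suc n \<Rightarrow> conv_num s n)"

definition qq :: "nat \<Rightarrow> int" where
  "qq k = (case k of 0 \<Rightarrow> 0 | Suc n \<Rightarrow> conv_denom s n)"

lemma pp_0: "pp 0 = 1" and qq_0: "qq 0 = 0"
  and pp_1: "pp (Suc 0) = \<lfloor>s\<rfloor>" and qq_1: "qq (Suc 0) = 1"
  by (simp_all add: pp_def qq_def partial_quotient_def)

lemma pp_Suc_Suc: "pp (Suc (Suc n)) = \<lfloor>xi (Suc n)\<rfloor> * pp (Suc n) + pp n"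
  and qq_Suc_Suc: "qq (Suc (Suc n)) = \<lfloor>xi (Suc n)\<rfloor> * qq (Suc n) + qq n"
  by (cases n; simp add: pp_def qq_def partial_quotient_pos)+

lemma pp_nonneg: "0 \<le> pp n" and qq_nonneg: "0 \<le> qq n"
proof -
  have "0 \<le> pp n \<and> 0 \<le> qq n \<and> 0 \<le> pp (Suc n) \<and> 0 \<le> qq (Suc n)"
  proof (induction n)
    case 0
    then show ?case using floor_s_pos by (simp add: pp_0 qq_0 pp_1 qq_1)
  next
    case (Suc n)
    moreover have "0 \<le> \<lfloor>xi (Suc n)\<rfloor>" using xi_gt_1[of "Suc n"] by linarith
    ultimately show ?case by (simp add: pp_Suc_Suc qq_Suc_Suc)
  qed
  then show "0 \<le> pp n" "0 \<le> qq n" by auto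
qed

lemma det: "pp (Suc n) * qq n - pp n * qq (Suc n) = (-1) ^ Suc n"
proof (induction n)
  case (Suc n)
  then show ?case by (simp add: pp_Suc_Suc qq_Suc_Suc algebra_simps)
qed (simp add: pp_0 qq_0 pp_1 qq_1)

lemma u_1: "int (u (Suc 0)) = \<lfloor>s\<rfloor>"
proof -
  have "\<lfloor>xi 0\<rfloor> = 2 * \<lfloor>s\<rfloor>" by (simp add: xi_def)
  then show ?thesis using u_Suc[of 0] u_0 v_0 by simp
qed

text \<open>
  After multiplication by \<open>v\<^sub>n\<^sub>+\<^sub>1\<close>, these are the coefficient of \<open>s\<close> and the rational part in
  \<open>s (q\<^sub>n xi\<^sub>n\<^sub>+\<^sub>1 + q\<^sub>n\<^sub>-\<^sub>1) = p\<^sub>n xi\<^sub>n\<^sub>+\<^sub>1 + p\<^sub>n\<^sub>-\<^sub>1\<close>.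
\<close>

lemma convergent_identities:
  "qq (Suc n) * int (u (Suc n)) + qq n * int (v (Suc n)) = pp (Suc n)"
  "pp (Suc n) * int (u (Suc n)) + pp n * int (v (Suc n)) = int d * qq (Suc n)"
proof -
  have "qq (Suc n) * int (u (Suc n)) + qq n * int (v (Suc n)) = pp (Suc n) \<and>
    pp (Suc n) * int (u (Suc n)) + pp n * int (v (Suc n)) = int d * qq (Suc n)"
  proof (induction n)
    case 0
    show ?case
      using v_Suc[of 0] by (simp add: pp_0 qq_0 pp_1 qq_1 u_1 v_0 power2_eq_square)
  next
    case (Suc n)
    let ?A = "\<lfloor>xi (Suc n)\<rfloor>"
    let ?v = "int (v (Suc n))" and ?v' = "int (v (Suc (Suc n)))"
      and ?u = "int (u (Suc n))" and ?u' = "int (u (Suc (Suc n)))"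
    note U = u_Suc[of "Suc n"] and V = v_Suc[of "Suc n"]
    \<comment> \<open>The recurrence for \<open>v\<close> gives only the product \<open>?v * ?v'\<close>, so both identities are proved after
      multiplication by \<open>?v\<close>.\<close>
    have q: "qq (Suc (Suc n)) * ?v = qq (Suc n) * ?u' + pp (Suc n)"
      using Suc unfolding qq_Suc_Suc U by (simp add: algebra_simps)
    have p: "pp (Suc (Suc n)) * ?v = pp (Suc n) * ?u' + int d * qq (Suc n)"
      using Suc unfolding pp_Suc_Suc U by (simp add: algebra_simps)
    have v0: "?v \<noteq> 0" using v_pos[of "Suc n"] by simp
    have "?v * (qq (Suc (Suc n)) * ?u' + qq (Suc n) * ?v')
        = (qq (Suc n) * ?u' + pp (Suc n)) * ?u' + qq (Suc n) * (int d - ?u'\<^sup>2)"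
      unfolding V[symmetric] q[symmetric] by (simp add: algebra_simps)
    also have "\<dots> = ?v * pp (Suc (Suc n))"
      using p by (simp add: algebra_simps power2_eq_square)
    finally have 1: "qq (Suc (Suc n)) * ?u' + qq (Suc n) * ?v' = pp (Suc (Suc n))"
      using v0 by simp
    have "?v * (pp (Suc (Suc n)) * ?u' + pp (Suc n) * ?v')
        = (pp (Suc n) * ?u' + int d * qq (Suc n)) * ?u' + pp (Suc n) * (int d - ?u'\<^sup>2)"
      unfolding V[symmetric] p[symmetric] by (simp add: algebra_simps)
    also have "\<dots> = ?v * (int d * qq (Suc (Suc n)))"
      using q by (simp add: algebra_simps power2_eq_square)
    finally have "pp (Suc (Suc n)) * ?u' + pp (Suc n) * ?v' = int d * qq (Suc (Suc n))"
      using v0 by simp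
    with 1 show ?case by simp
  qed
  then show "qq (Suc n) * int (u (Suc n)) + qq n * int (v (Suc n)) = pp (Suc n)"
    "pp (Suc n) * int (u (Suc n)) + pp n * int (v (Suc n)) = int d * qq (Suc n)"
    by auto
qed

lemma norm_convergent: "(pp (Suc n))\<^sup>2 - int d * (qq (Suc n))\<^sup>2 = (-1) ^ Suc n * int (v (Suc n))"
proof -
  have "(pp (Suc n))\<^sup>2 - int d * (qq (Suc n))\<^sup>2
      = pp (Suc n) * (qq (Suc n) * int (u (Suc n)) + qq n * int (v (Suc n)))
        - qq (Suc n) * (pp (Suc n) * int (u (Suc n)) + pp n * int (v (Suc n)))"
    unfolding convergent_identities by (simp add: power2_eq_square algebra_simps)
  also have "\<dots> = (pp (Suc n) * qq n - pp n * qq (Suc n)) * int (v (Suc n))"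
    by (simp add: algebra_simps)
  finally show ?thesis unfolding det .
qed

text \<open>
  Up to sign, the norm form \<open>P\<^sup>2 - d Q\<^sup>2\<close> in the coordinates \<open>(x, y)\<close> of \<open>(P, Q)\<close> with respect to the
  basis formed by the columns \<open>(pp, qq)\<close> of indices \<open>n + 1\<close> and \<open>n\<close>. It factors as
  \<open>V (x - xi y) (x + eta y)\<close> with \<open>V = v\<^sub>n\<^sub>+\<^sub>1\<close>, \<open>xi = xi\<^sub>n\<^sub>+\<^sub>1 > 1\<close>, \<open>eta = (s - u\<^sub>n\<^sub>+\<^sub>1) / V > 0\<close>, so that
  \<open>V (xi + eta) = 2 s\<close>.
\<close>

definition form :: "nat \<Rightarrow> int \<Rightarrow> int \<Rightarrow> int" where
  "form n x y = int (v (Suc n)) * x\<^sup>2 - 2 * int (u (Suc n)) * x * y - int (v n) * y\<^sup>2"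

lemma form_step:
  "form (Suc n) y (x - \<lfloor>xi (Suc n)\<rfloor> * y) = - form n x y"
proof -
  let ?v = "int (v (Suc n))" and ?A = "\<lfloor>xi (Suc n)\<rfloor>" and ?u = "int (u (Suc n))"
  have "?v * int (v (Suc (Suc n))) = int d - (?A * ?v - ?u)\<^sup>2"
    using v_Suc[of "Suc n"] u_Suc[of "Suc n"] by simp
  also have "\<dots> = ?v * (int (v n) + ?A * (2 * ?u - ?A * ?v))"
    using v_Suc[of n] by (simp add: algebra_simps power2_eq_square)
  finally have v: "int (v (Suc (Suc n))) = int (v n) + ?A * (2 * ?u - ?A * ?v)"
    using v_pos[of "Suc n"] by simp
  show ?thesis
    unfolding form_def v u_Suc[of "Suc n"] by (simp add: algebra_simps power2_eq_square)
qed

text \<open>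
  Otherwise the factors \<open>X = xi y - x\<close> and \<open>Y = x + eta y\<close> are both at least \<open>1\<close>, and then
  \<open>X Y \<ge> X + Y - 1 = (xi + eta) y - 1 \<ge> (xi + eta) / 2\<close>. Multiplied by \<open>V\<close> this says that the form is at
  least \<open>s\<close> in absolute value.
\<close>

lemma form_small:
  assumes "1 \<le> x" "1 \<le> y" and small: "\<bar>of_int (form n x y)\<bar> < s"
  shows "\<lfloor>xi (Suc n)\<rfloor> * y \<le> x"
proof (rule ccontr)
  let ?A = "\<lfloor>xi (Suc n)\<rfloor>"
  assume "\<not> ?A * y \<le> x"
  then have le: "x + 1 \<le> ?A * y" by simp
  define V where "V = real (v (Suc n))"
  define eta where "eta = (s - real (u (Suc n))) / V"
  define X where "X = xi (Suc n) * of_int y - of_int x"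
  define Y where "Y = of_int x + eta * of_int y"
  have V: "0 < V" using v_pos by (simp add: V_def)
  have eta: "0 < eta" using u_lt[of "Suc n"] V by (simp add: eta_def)
  have Vxi: "V * xi (Suc n) = real (u (Suc n)) + s" and Veta: "V * eta = s - real (u (Suc n))"
    using V by (simp_all add: xi_eq V_def eta_def)
  have y: "1 \<le> (of_int y :: real)" and x: "1 \<le> (of_int x :: real)" using assms by simp_all
  have "of_int (x + 1) \<le> (of_int (?A * y) :: real)" using le by (simp only: of_int_le_iff)
  also have "\<dots> \<le> xi (Suc n) * of_int y"
    using y by (simp add: mult_right_mono)
  finally have X: "1 \<le> X" by (simp add: X_def)
  have Y: "1 \<le> Y" using x y eta by (simp add: Y_def add_increasing2)
  have sum: "X + Y = (xi (Suc n) + eta) * of_int y" by (simp add: X_def Y_def algebra_simps)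
  have "0 \<le> (X - 1) * (Y - 1)" using X Y by simp
  then have "(xi (Suc n) + eta) * of_int y - 1 \<le> X * Y"
    using sum by (simp add: algebra_simps)
  \<comment> \<open>For \<open>y = 1\<close> the bound needs \<open>xi + eta \<ge> 2\<close>, which holds because \<open>1 \<le> x < \<lfloor>xi\<rfloor>\<close>.\<close>
  moreover have "(xi (Suc n) + eta) / 2 \<le> (xi (Suc n) + eta) * of_int y - 1"
  proof (cases "y = 1")
    case True
    then have "x + 1 \<le> ?A" using le by simp
    then have "2 \<le> ?A" using assms(1) by linarith
    then have "2 \<le> xi (Suc n)" by linarith
    then show ?thesis using True eta by simp
  next
    case False
    then have "2 \<le> (of_int y :: real)" using assms(2) by linarith
    then have "(xi (Suc n) + eta) * 2 \<le> (xi (Suc n) + eta) * of_int y"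
      using xi_gt_1[of "Suc n"] eta by (intro mult_left_mono) auto
    then show ?thesis using xi_gt_1[of "Suc n"] eta by simp
  qed
  ultimately have "V * ((xi (Suc n) + eta) / 2) \<le> V * (X * Y)"
    using V by (intro mult_left_mono) auto
  then have lower: "s \<le> V * (X * Y)"
    using Vxi Veta by (simp add: distrib_left field_simps)
  have prod: "V * (xi (Suc n) * eta) = real (v n)"
  proof -
    have "V * (V * (xi (Suc n) * eta)) = (V * xi (Suc n)) * (V * eta)" by simp
    also have "\<dots> = real d - (real (u (Suc n)))\<^sup>2"
      unfolding Vxi Veta using s_squared by (simp add: algebra_simps power2_eq_square)
    also have "\<dots> = V * real (v n)"
      using arg_cong[OF v_Suc[of n], of real_of_int] by (simp add: V_def mult.commute)
    finally show ?thesis using V by simp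
  qed
  have "V * (X * Y) = - (V * of_int x * of_int x - (V * xi (Suc n) - V * eta) * of_int x * of_int y
      - V * (xi (Suc n) * eta) * of_int y * of_int y)"
    by (simp add: X_def Y_def algebra_simps)
  also have "\<dots> = - of_int (form n x y)"
    unfolding prod unfolding Vxi Veta by (simp add: form_def V_def power2_eq_square algebra_simps)
  finally show False using lower small by linarith
qed

text \<open>
  Passing to the basis of the next index replaces \<open>(x, y)\<close> by \<open>(y, x - \<lfloor>xi\<rfloor> y)\<close>. By \<open>form_small\<close> the
  new coordinates are again nonnegative, and their sum is smaller, so coprimality forces
  the descent to end at \<open>(1, 0)\<close>, that is, at a basis vector.
\<close>

lemma form_descent:
  assumes "1 \<le> x" "0 \<le> y" "coprime x y" "\<bar>of_int (form n x y)\<bar> < s"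
  shows "\<exists>k\<ge>1. pp (Suc n) * x + pp n * y = pp k \<and> qq (Suc n) * x + qq n * y = qq k"
  using assms
proof (induction "nat (x + y)" arbitrary: n x y rule: less_induct)
  case less
  show ?case
  proof (cases "y = 0")
    case True
    then have "x = 1" using less.prems by auto
    then show ?thesis using True by (intro exI[of _ "Suc n"]) simp
  next
    case False
    define A r where "A = \<lfloor>xi (Suc n)\<rfloor>" and "r = x - A * y"
    have y: "1 \<le> y" using False less.prems by simp
    have A: "1 \<le> A" using xi_gt_1[of "Suc n"] unfolding A_def by linarith
    have r: "0 \<le> r" using form_small[OF less.prems(1) y less.prems(4)] by (simp add: r_def A_def)
    have "1 * y \<le> A * y" using A y by (intro mult_right_mono) auto
    then have "nat (y + r) < nat (x + y)" using y r less.prems(1) by (simp add: r_def)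
    moreover have "coprime y r"
    proof -
      have "gcd y (x - A * y) = gcd y x"
        using gcd_add_mult[of y "- A" x] by (simp add: algebra_simps)
      then show ?thesis
        using less.prems(3) by (simp add: r_def coprime_iff_gcd_eq_1 gcd.commute)
    qed
    moreover have "\<bar>of_int (form (Suc n) y r)\<bar> < s"
      using less.prems(4) form_step[of n y x] by (simp add: r_def A_def)
    ultimately obtain k where "k \<ge> 1"
      "pp (Suc (Suc n)) * y + pp (Suc n) * r = pp k" "qq (Suc (Suc n)) * y + qq (Suc n) * r = qq k"
      using less.hyps[OF _ y r, of "Suc n"] by blast
    then show ?thesis
      by (intro exI[of _ k])
        (simp add: pp_Suc_Suc qq_Suc_Suc r_def A_def[symmetric] algebra_simps)
  qed
qed

text \<open>
  Lagrange's theorem. Descending on the form treats both signs of the norm at once, while the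
  criterion \<open>\<bar>s - P / Q\<bar> < 1 / (2 Q\<^sup>2)\<close> covers only the positive one directly. The descent starts at
  the basis \<open>(\<lfloor>s\<rfloor>, 1)\<close>, \<open>(1, 0)\<close>, in which \<open>(P, Q)\<close> has the coordinates \<open>(Q, P - \<lfloor>s\<rfloor> Q)\<close>.
\<close>

theorem small_norm_convergent:
  fixes P Q :: int
  assumes "0 \<le> P" "1 \<le> Q" "coprime P Q" and small: "\<bar>of_int (P\<^sup>2 - int d * Q\<^sup>2)\<bar> < s"
  obtains k where "1 \<le> k" "P = pp k" "Q = qq k"
proof -
  have ge: "\<lfloor>s\<rfloor> * Q \<le> P"
  proof (rule ccontr)
    assume "\<not> \<lfloor>s\<rfloor> * Q \<le> P"
    then have "P + 1 \<le> \<lfloor>s\<rfloor> * Q" by simp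
    then have "of_int (P + 1) \<le> (of_int (\<lfloor>s\<rfloor> * Q) :: real)" by (simp only: of_int_le_iff)
    also have "\<dots> \<le> s * of_int Q" using assms(2) by (simp add: mult_right_mono)
    finally have 1: "1 \<le> s * of_int Q - of_int P" by simp
    have "s * 1 \<le> s * of_int Q" using assms(2) s_gt_1 by (intro mult_left_mono) auto
    then have 2: "s \<le> s * of_int Q + of_int P" using assms(1) by (simp add: add_increasing2)
    have "1 * s \<le> (s * of_int Q - of_int P) * (s * of_int Q + of_int P)"
      using 1 2 s_gt_1 by (intro mult_mono) auto
    also have "\<dots> = (s * s) * (of_int Q)\<^sup>2 - (of_int P)\<^sup>2"
      by (simp add: power2_eq_square algebra_simps)
    also have "\<dots> = - of_int (P\<^sup>2 - int d * Q\<^sup>2)" by (simp add: s_squared)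
    finally show False using small by linarith
  qed
  have "form 0 Q (P - \<lfloor>s\<rfloor> * Q) = - (P\<^sup>2 - int d * Q\<^sup>2)"
  proof -
    have v_1: "int (v (Suc 0)) = int d - \<lfloor>s\<rfloor>\<^sup>2" using v_Suc[of 0] v_0 u_1 by simp
    show ?thesis
      unfolding form_def u_1 v_0 v_1 by (simp add: power2_eq_square algebra_simps)
  qed
  then have f: "\<bar>of_int (form 0 Q (P - \<lfloor>s\<rfloor> * Q))\<bar> < s" using small by simp
  have "gcd Q (P - \<lfloor>s\<rfloor> * Q) = gcd Q P"
    using gcd_add_mult[of Q "- \<lfloor>s\<rfloor>" P] by (simp add: algebra_simps)
  then have "coprime Q (P - \<lfloor>s\<rfloor> * Q)"
    using assms(3) by (simp add: coprime_iff_gcd_eq_1 gcd.commute)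
  from form_descent[OF assms(2) _ this f] ge show ?thesis
    using that by (auto simp: pp_0 qq_0 pp_1 qq_1)
qed

section \<open>The equation\<close>

text \<open>
  Multiplication by \<open>c\<close> turns the equation into \<open>(c x)\<^sup>2 - d y\<^sup>2 = \<plusminus>c\<close>. The inequality \<open>c < e\<close> ensures
  \<open>c\<^sup>2 < c e = d\<close>, so this value is within reach of Lagrange's theorem.
\<close>

lemma solution_index:
  fixes c e x y :: nat and \<sigma> :: int
  assumes "2 \<le> c" "c < e" "d = c * e" "\<bar>\<sigma>\<bar> = 1"
    and eq: "int c * (int x)\<^sup>2 - int e * (int y)\<^sup>2 = \<sigma>"
  obtains k where "1 \<le> k" "int (c * x) = pp k" "int y = qq k"
    "(-1) ^ k = \<sigma>" "v k = c" "c dvd u k"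
proof -
  have cop: "coprime (int c * int x) (int y)"
  proof (rule coprimeI)
    fix g assume g: "g dvd int c * int x" "g dvd int y"
    have "\<sigma> = (int c * int x) * int x - int y * (int e * int y)"
      using eq by (simp add: power2_eq_square algebra_simps)
    then have "g dvd \<sigma>" using g by (metis dvd_diff dvd_mult2)
    then show "is_unit g" using assms(4) by (metis dvd_abs_iff)
  qed
  have "y \<noteq> 0"
  proof
    assume "y = 0"
    then have "\<bar>int c * (int x)\<^sup>2\<bar> = 1" using eq assms(4) by simp
    then have "int c dvd 1" by (metis dvd_abs_iff dvd_triv_left)
    then show False using assms(1) by simp
  qed
  have norm: "(int (c * x))\<^sup>2 - int d * (int y)\<^sup>2 = int c * \<sigma>"
    unfolding eq[symmetric] by (simp add: assms(3) power2_eq_square algebra_simps)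
  have "real c < s"
  proof -
    have "c * c < d" using assms by simp
    then have "(real c)\<^sup>2 < real d" by (metis of_nat_less_iff of_nat_mult power2_eq_square)
    then show ?thesis by (simp add: s_def real_less_rsqrt)
  qed
  then have "\<bar>of_int ((int (c * x))\<^sup>2 - int d * (int y)\<^sup>2)\<bar> < s"
    unfolding norm using assms(4) by (simp add: abs_mult flip: of_int_abs)
  then obtain k where k: "1 \<le> k" "int (c * x) = pp k" "int y = qq k"
    using small_norm_convergent[of "int (c * x)" "int y"] cop \<open>y \<noteq> 0\<close> by auto
  then obtain n where n: "k = Suc n" by (cases k) auto
  have nv: "(-1) ^ k * int (v k) = int c * \<sigma>"
    using norm norm_convergent[of n] k n by simp
  then have "\<bar>(-1) ^ k * int (v k)\<bar> = \<bar>int c * \<sigma>\<bar>" by simp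
  then have vk: "v k = c" using assms(4) by (simp add: abs_mult power_abs)
  then have sgn: "(-1) ^ k = \<sigma>" using nv assms(1) by simp
  have "int y * int (u k) = int c * (int x - qq n)"
    using convergent_identities(1)[of n] k n vk by (simp add: algebra_simps)
  then have "int c dvd int y * int (u k)" by simp
  moreover have "coprime (int c) (int y)" using cop by simp
  ultimately have "c dvd u k" by (simp add: coprime_dvd_mult_right_iff)
  then show ?thesis using that k sgn vk by blast
qed

lemma index_solution:
  fixes c e k :: nat
  assumes "d = c * e" "1 \<le> k" "v k = c" "c dvd u k"
  obtains x y :: nat where "int (c * x) = pp k" "int y = qq k"
    "int c * (int x)\<^sup>2 - int e * (int y)\<^sup>2 = (-1) ^ k"
proof -
  obtain n where n: "k = Suc n" using assms(2) by (cases k) auto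
  have "int c dvd int (u k)" using assms(4) by simp
  then have "int c dvd qq (Suc n) * int (u (Suc n)) + qq n * int (v (Suc n))"
    using assms(3) n by simp
  then have "int c dvd pp k" using convergent_identities(1) n by simp
  then obtain z where z: "pp k = int c * z" by blast
  have c: "0 < c" using v_pos assms(3) by blast
  have "0 \<le> z" using pp_nonneg[of k] z c by (simp add: zero_le_mult_iff)
  define x y where "x = nat z" and "y = nat (qq k)"
  have xy: "int (c * x) = pp k" "int y = qq k"
    using \<open>0 \<le> z\<close> z qq_nonneg by (simp_all add: x_def y_def)
  have "int c * (int c * (int x)\<^sup>2 - int e * (int y)\<^sup>2) = (int (c * x))\<^sup>2 - int d * (int y)\<^sup>2"
    by (simp add: assms(1) power2_eq_square algebra_simps)
  also have "\<dots> = int c * (-1) ^ k"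
    unfolding xy using norm_convergent[of n] n assms(3) by simp
  finally have "int c * (int x)\<^sup>2 - int e * (int y)\<^sup>2 = (-1) ^ k"
    using c by simp
  then show ?thesis using that xy by blast
qed

lemma half_index_solution:
  fixes c e l :: nat
  assumes "2 \<le> c" "d = c * e" "even T" "v (T div 2) = c" "c dvd u (T div 2)"
  obtains x y :: nat where "int (c * x) = pp (T div 2 + l * T)" "int y = qq (T div 2 + l * T)"
    "int c * (int x)\<^sup>2 - int e * (int y)\<^sup>2 = (-1) ^ (T div 2)"
proof -
  have "v (T div 2) dvd 2 * u (T div 2)" "v (T div 2) \<noteq> 1" using assms by auto
  then have vT: "v T = 1" by (rule symmetric_state)
  have "T div 2 \<noteq> 0" using assms(1,4) v_0 by (cases "T div 2 = 0") auto
  moreover have "(-1 :: int) ^ (T div 2 + l * T) = (-1) ^ (T div 2)"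
    using assms(3) by (simp add: power_add)
  ultimately show ?thesis
    using index_solution[OF assms(2), of "T div 2 + l * T"] state_shift_mult[OF vT] assms(4,5) that
    by (metis add_is_0 less_one linorder_not_less)
qed

lemma solution_half_index:
  fixes c e x y :: nat and \<sigma> :: int
  assumes "2 \<le> c" "c < e" "d = c * e" "\<bar>\<sigma>\<bar> = 1"
    and "int c * (int x)\<^sup>2 - int e * (int y)\<^sup>2 = \<sigma>"
  obtains l where "even T" "(-1) ^ (T div 2) = \<sigma>" "v (T div 2) = c" "c dvd u (T div 2)"
    "int (c * x) = pp (T div 2 + l * T)" "int y = qq (T div 2 + l * T)"
proof -
  obtain k where k: "1 \<le> k" "int (c * x) = pp k" "int y = qq k"
    "(-1) ^ k = \<sigma>" "v k = c" "c dvd u k"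
    using solution_index[OF assms] .
  have "v k dvd 2 * u k" "v k \<noteq> 1" using k assms(1) by auto
  then obtain l where l: "even T" "k = T div 2 + l * T" "v T = 1" by (rule symmetric_state)
  moreover have "(-1 :: int) ^ k = (-1) ^ (T div 2)"
    using l by (simp add: power_add)
  ultimately show ?thesis
    using that[of l] k state_shift_mult[OF l(3)] by metis
qed

theorem solution_set:
  fixes c e :: nat and \<sigma> :: int
  assumes "2 \<le> c" "c < e" "d = c * e" "\<bar>\<sigma>\<bar> = 1"
  defines "S \<equiv> {(x, y). int c * (int x)\<^sup>2 - int e * (int y)\<^sup>2 = \<sigma>}"
    and "N \<equiv> T div 2"
  shows "S \<noteq> {} \<longleftrightarrow> even T \<and> (-1) ^ N = \<sigma> \<and> v N = c \<and> v N dvd u N"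
    and "S \<noteq> {} \<Longrightarrow> (\<lambda>(x, y). (real x, real y)) ` S
      = {(of_int (conv_num s (N - 1 + l * T)) / real c, of_int (conv_denom s (N - 1 + l * T))) | l. True}"
proof -
  show iff: "S \<noteq> {} \<longleftrightarrow> even T \<and> (-1) ^ N = \<sigma> \<and> v N = c \<and> v N dvd u N"
  proof
    assume "S \<noteq> {}"
    then obtain x y where "int c * (int x)\<^sup>2 - int e * (int y)\<^sup>2 = \<sigma>" by (auto simp: S_def)
    from solution_half_index[OF assms(1-4) this]
    show "even T \<and> (-1) ^ N = \<sigma> \<and> v N = c \<and> v N dvd u N" by (metis N_def)
  next
    assume "even T \<and> (-1) ^ N = \<sigma> \<and> v N = c \<and> v N dvd u N"
    then have H: "even T" "(-1) ^ N = \<sigma>" "v N = c" "c dvd u N" by auto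
    obtain x y where "int c * (int x)\<^sup>2 - int e * (int y)\<^sup>2 = (-1) ^ N"
      using half_index_solution[OF assms(1,3) H(1) H(3,4)[unfolded N_def], of 0, folded N_def] .
    then show "S \<noteq> {}" using H(2) by (auto simp: S_def)
  qed
  assume "S \<noteq> {}"
  then have H: "even T" "(-1) ^ N = \<sigma>" "v N = c" "c dvd u N" using iff by auto
  have "N \<noteq> 0" using assms(1) H(3) v_0 by (cases "N = 0") auto
  then have idx: "N + l * T = Suc (N - 1 + l * T)" for l by simp
  have conv: "conv_num s (N - 1 + l * T) = pp (N + l * T)"
    "conv_denom s (N - 1 + l * T) = qq (N + l * T)" for l
    unfolding idx by (simp_all add: pp_def qq_def)
  have real_eq: "real x = of_int (pp k) / real c" "real y = of_int (qq k)"
    if "int (c * x) = pp k" "int y = qq k" for x y k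
    unfolding that[symmetric] using assms(1) by simp_all
  show "(\<lambda>(x, y). (real x, real y)) ` S
      = {(of_int (conv_num s (N - 1 + l * T)) / real c, of_int (conv_denom s (N - 1 + l * T))) | l. True}"
    unfolding conv
  proof (intro equalityI subsetI)
    fix z assume "z \<in> (\<lambda>(x, y). (real x, real y)) ` S"
    then obtain x y where z: "z = (real x, real y)"
      and "int c * (int x)\<^sup>2 - int e * (int y)\<^sup>2 = \<sigma>" by (auto simp: S_def)
    from solution_half_index[OF assms(1-4) this(2)] obtain l
      where "int (c * x) = pp (N + l * T)" "int y = qq (N + l * T)" by (metis N_def)
    then show "z \<in> {(of_int (pp (N + l * T)) / real c, of_int (qq (N + l * T))) | l. True}"
      using real_eq z by blast
  next
    fix z assume "z \<in> {(of_int (pp (N + l * T)) / real c, real_of_int (qq (N + l * T))) | l. True}"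
    then obtain l where z: "z = (of_int (pp (N + l * T)) / real c, of_int (qq (N + l * T)))" by blast
    obtain x y where xy: "int (c * x) = pp (N + l * T)" "int y = qq (N + l * T)"
      "int c * (int x)\<^sup>2 - int e * (int y)\<^sup>2 = (-1) ^ N"
      using half_index_solution[OF assms(1,3) H(1) H(3,4)[unfolded N_def], of l, folded N_def] .
    then have "(x, y) \<in> S" using H(2) by (simp add: S_def)
    moreover have "z = (real x, real y)" using z real_eq[OF xy(1,2)] by simp
    ultimately show "z \<in> (\<lambda>(x, y). (real x, real y)) ` S" by force
  qed
qed

end

theorem mainTheorem2:
  fixes a b d T N :: nat and u v :: "nat \<Rightarrow> nat" and p q :: "nat \<Rightarrow> int"
    and E2 :: "(real \<times> real) set"
  assumes "2 \<le> a" and "2 \<le> b" and "coprime a b"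
    and "d = a * b" and "\<not> is_square d"
    and "associated_seqs d u v"
    and "p = conv_num (sqrt (real d))" and "q = conv_denom (sqrt (real d))"
    and "T = cf_period (sqrt (real d))" and "N = T div 2"
    and "E2 = {(x, y). x \<in> \<nat> \<and> y \<in> \<nat> \<and> real a * x\<^sup>2 - real b * y\<^sup>2 = 1}"
  shows
    "(a < b \<longrightarrow>
        (E2 \<noteq> {} \<longleftrightarrow> T mod 4 = 0 \<and> v N = a \<and> v N dvd u N) \<and>
        (E2 \<noteq> {} \<longrightarrow>
           E2 = {(real_of_int (p (N - 1 + l * T)) / real a, real_of_int (q (N - 1 + l * T))) | l. True})) \<and>
     (b < a \<longrightarrow>
        (E2 \<noteq> {} \<longleftrightarrow> T mod 4 = 2 \<and> v N = b \<and> v N dvd u N) \<and>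
        (E2 \<noteq> {} \<longrightarrow>
           E2 = {(real_of_int (q (N - 1 + l * T)), real_of_int (p (N - 1 + l * T)) / real b) | l. True})) \<and>
     (odd T \<longrightarrow> E2 = {})"
proof -
  interpret cf: sqrt_cf d u v
    using assms by unfold_locales
  have s: "sqrt (real d) = cf.s" and T: "T = cf.T" and N: "N = cf.T div 2"
    unfolding cf.T_def cf.s_def assms(10) assms(9) by (rule refl)+
  note p = assms(7)[unfolded s] and q = assms(8)[unfolded s]
  \<comment> \<open>In \<open>S2\<close> the coordinates are exchanged: the unknown with the smaller coefficient comes first.\<close>
  define S1 where "S1 = {(x, y). int a * (int x)\<^sup>2 - int b * (int y)\<^sup>2 = 1}"
  define S2 where "S2 = {(y, x). int b * (int y)\<^sup>2 - int a * (int x)\<^sup>2 = -1}"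
  have cast: "real a * (real x)\<^sup>2 - real b * (real y)\<^sup>2 = 1 \<longleftrightarrow>
      int a * (int x)\<^sup>2 - int b * (int y)\<^sup>2 = 1" for x y
  proof -
    have "real a * (real x)\<^sup>2 - real b * (real y)\<^sup>2
        = of_int (int a * (int x)\<^sup>2 - int b * (int y)\<^sup>2)" by simp
    then show ?thesis by (metis of_int_eq_1_iff)
  qed
  have E2_1: "E2 = (\<lambda>(x, y). (real x, real y)) ` S1"
    unfolding assms(11) S1_def using cast by (force elim!: Nats_cases)
  have "S1 = prod.swap ` S2"
    unfolding S1_def S2_def by (force simp: image_iff)
  then have E2_2: "E2 = prod.swap ` (\<lambda>(x, y). (real x, real y)) ` S2"
    unfolding E2_1 by (force simp: image_iff)
  have mod0: "even T \<and> (-1 :: int) ^ N = 1 \<longleftrightarrow> T mod 4 = 0"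
    and mod2: "even T \<and> (-1 :: int) ^ N = -1 \<longleftrightarrow> T mod 4 = 2"
    unfolding assms(10) by (auto simp: minus_one_power_iff elim!: evenE split: if_splits; presburger)+
  have less: "(E2 \<noteq> {} \<longleftrightarrow> T mod 4 = 0 \<and> v N = a \<and> v N dvd u N) \<and>
        (E2 \<noteq> {} \<longrightarrow>
           E2 = {(real_of_int (p (N - 1 + l * T)) / real a, real_of_int (q (N - 1 + l * T))) | l. True})"
    if "a < b"
  proof -
    note sol = cf.solution_set[OF assms(1) that assms(4), of 1, folded S1_def N T]
    have nonempty: "E2 \<noteq> {} \<longleftrightarrow> S1 \<noteq> {}" unfolding E2_1 by simp
    have set: "E2 = {(real_of_int (p (N - 1 + l * T)) / real a, real_of_int (q (N - 1 + l * T))) | l. True}"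
      if "S1 \<noteq> {}"
      using sol(2)[OF _ that] unfolding p q E2_1 by simp
    have iff: "S1 \<noteq> {} \<longleftrightarrow> T mod 4 = 0 \<and> v N = a \<and> v N dvd u N"
      unfolding sol(1)[OF abs_one] mod0[symmetric] by blast
    show ?thesis
      by (rule conjI[OF trans[OF nonempty iff] impI], rule set, erule iffD1[OF nonempty])
  qed
  have greater: "(E2 \<noteq> {} \<longleftrightarrow> T mod 4 = 2 \<and> v N = b \<and> v N dvd u N) \<and>
        (E2 \<noteq> {} \<longrightarrow>
           E2 = {(real_of_int (q (N - 1 + l * T)), real_of_int (p (N - 1 + l * T)) / real b) | l. True})"
    if "b < a"
  proof -
    have "d = b * a" using assms(4) by simp
    note sol = cf.solution_set[OF assms(2) that this, of "-1", folded S2_def N T]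
    have nonempty: "E2 \<noteq> {} \<longleftrightarrow> S2 \<noteq> {}" unfolding E2_2 by simp
    have set: "E2 = {(real_of_int (q (N - 1 + l * T)), real_of_int (p (N - 1 + l * T)) / real b) | l. True}"
      if "S2 \<noteq> {}"
      unfolding E2_2 sol(2)[OF _ that, simplified] p q by (force simp: image_iff)
    have "S2 \<noteq> {} \<longleftrightarrow> even T \<and> (-1) ^ N = (-1 :: int) \<and> v N = b \<and> v N dvd u N"
      by (rule sol(1)) simp
    then have iff: "S2 \<noteq> {} \<longleftrightarrow> T mod 4 = 2 \<and> v N = b \<and> v N dvd u N"
      unfolding mod2[symmetric] by blast
    show ?thesis
      by (rule conjI[OF trans[OF nonempty iff] impI], rule set, erule iffD1[OF nonempty])
  qed
  have "E2 = {}" if "odd T"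
  proof -
    have no: "T mod 4 \<noteq> 0" "T mod 4 \<noteq> 2" using that by presburger+
    have "a \<noteq> b" using assms(4,5) by (metis is_nth_power_def power2_eq_square)
    then show ?thesis
    proof (rule linorder_neqE_nat)
      assume "a < b"
      from conjunct1[OF less[OF this]] no(1) show ?thesis by blast
    next
      assume "b < a"
      from conjunct1[OF greater[OF this]] no(2) show ?thesis by blast
    qed
  qed
  then show ?thesis by (intro conjI[OF impI[OF less] conjI[OF impI[OF greater] impI]])
qed

end
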